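(* Let $k\ge 2$ and let $\mathcal G=(G,R)$ be the generic $k$-hypergraph. There is a unique even $(k+1)$-hypergraph $\mathcal G'=(G\cup\{0\},R')$ (with $0\notin G$ a new element) satisfying $$R(\overline{x})\Longleftrightarrow R'(\overline{x},0)$$ for all $k$-tuples $\overline{x}$ from $G$. Moreover $\mathcal G'$ is the generic even $(k+1)$-hypergraph, and it is a transitive one-point extension of $\mathcal G$.
   Context: **Extensions.** Let $\mathcal M$ be a first-order structure with universe $M$. A one-point extension of $\mathcal M$ is a first-order structure $\mathcal M'$ (in any language) with universe $M\cup\{0\}$, where $0\notin M$ is a new element, such that the stabilizer $\mathrm{Aut}(\mathcal M')_0$ of $0$, acting on $M$, equals $\mathrm{Aut}(\mathcal M)$ as a permutation group on $M$. It is a transitive (one-point) extension if $\mathrm{Aut}(\mathcal M')$ acts transitively on $M\cup\{0\}$. **Generic structures.** For a Fraïssé class $\mathcal F$ of finitely generated structures, the generic member of $\mathcal F$ is its Fraïssé limit, i.e. the unique (up to isomorphism) countable ultrahomogeneous structure whose age is $\mathcal F$. **Hypergraphs.** A $k$-hypergraph is a structure $(G,R)$ where $R$ is a $k$-ary relation that is symmetric under all permutations of coordinates and irreflexive (fails on every tuple whose entries are not all distinct). A $k$-hypergraph is even if every set of $k+1$ points has an even number of $k$-element subsets which form a hyperedge. (So a $(k+1)$-hypergraph is even if every set of $k+2$ points contains an even number of $(k+1)$-hyperedges.) The generic $k$-hypergraph (resp. generic even $(k+1)$-hypergraph) is the generic member of the class of finite $k$-hypergraphs (resp. finite even $(k+1)$-hypergraphs).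 *)

theory Defs
  imports Main "HOL-Library.Countable_Set" "HOL-Combinatorics.Permutations"
begin

section \<open>First-order structures\<close>

record ('f, 'r) lang =
  fsyms  :: "'f set"
  farity :: "'f \<Rightarrow> nat"
  rsyms  :: "'r set"
  rarity :: "'r \<Rightarrow> nat"

text \<open>Empty universes are allowed. Function symbols are interpreted on lists of the right
  length over the universe; the values elsewhere are junk that no definition below inspects.\<close>

record ('f, 'r, 'a) fo_struct =
  univ :: "'a set"
  funs :: "'f \<Rightarrow> 'a list \<Rightarrow> 'a"
  rels :: "'r \<Rightarrow> 'a list \<Rightarrow> bool"

definition tuples :: "nat \<Rightarrow> 'a set \<Rightarrow> 'a list set" where
  "tuples n A = {xs. length xs = n \<and> set xs \<subseteq> A}"

definition fun_closed :: "('f, 'r) lang \<Rightarrow> ('f, 'r, 'a) fo_struct \<Rightarrow> 'a set \<Rightarrow> bool" where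
  "fun_closed L M A \<longleftrightarrow> (\<forall>f\<in>fsyms L. \<forall>xs\<in>tuples (farity L f) A. funs M f xs \<in> A)"

definition is_structure :: "('f, 'r) lang \<Rightarrow> ('f, 'r, 'a) fo_struct \<Rightarrow> bool" where
  "is_structure L M \<longleftrightarrow>
     fun_closed L M (univ M) \<and>
     (\<forall>r\<in>rsyms L. \<forall>xs. rels M r xs \<longrightarrow> xs \<in> tuples (rarity L r) (univ M))"

definition embedding ::
  "('f, 'r) lang \<Rightarrow> ('f, 'r, 'a) fo_struct \<Rightarrow> ('f, 'r, 'b) fo_struct \<Rightarrow> ('a \<Rightarrow> 'b) \<Rightarrow> bool" where
  "embedding L M N h \<longleftrightarrow>
     inj_on h (univ M) \<and> h ` univ M \<subseteq> univ N \<and>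
     (\<forall>f\<in>fsyms L. \<forall>xs\<in>tuples (farity L f) (univ M).
        h (funs M f xs) = funs N f (map h xs)) \<and>
     (\<forall>r\<in>rsyms L. \<forall>xs\<in>tuples (rarity L r) (univ M).
        rels M r xs \<longleftrightarrow> rels N r (map h xs))"

definition isomorphism ::
  "('f, 'r) lang \<Rightarrow> ('f, 'r, 'a) fo_struct \<Rightarrow> ('f, 'r, 'b) fo_struct \<Rightarrow> ('a \<Rightarrow> 'b) \<Rightarrow> bool" where
  "isomorphism L M N h \<longleftrightarrow> embedding L M N h \<and> h ` univ M = univ N"

text \<open>Following the convention of \<^const>\<open>permutes\<close>, automorphisms are functions on the whole
  type which are the identity outside the universe.\<close>

definition Aut :: "('f, 'r) lang \<Rightarrow> ('f, 'r, 'a) fo_struct \<Rightarrow> ('a \<Rightarrow> 'a) set" where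
  "Aut L M = {g. g permutes univ M \<and> isomorphism L M M g}"

section \<open>One-point extensions\<close>

text \<open>A permutation of \<open>insert z (univ M)\<close> that fixes \<open>z\<close> is already the identity outside
  \<open>univ M\<close>, so restricting the stabilizer of \<open>z\<close> to \<open>univ M\<close> leaves the functions unchanged and
  the two permutation groups can be compared as sets.\<close>

definition one_point_extension ::
  "('f, 'r) lang \<Rightarrow> ('f, 'r, 'a) fo_struct \<Rightarrow> 'a \<Rightarrow>
   ('g, 's) lang \<Rightarrow> ('g, 's, 'a) fo_struct \<Rightarrow> bool" where
  "one_point_extension L M z L' M' \<longleftrightarrow>
     is_structure L M \<and> is_structure L' M' \<and>
     z \<notin> univ M \<and> univ M' = insert z (univ M) \<and>
     {g \<in> Aut L' M'. g z = z} = Aut L M"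

definition transitive_one_point_extension ::
  "('f, 'r) lang \<Rightarrow> ('f, 'r, 'a) fo_struct \<Rightarrow> 'a \<Rightarrow>
   ('g, 's) lang \<Rightarrow> ('g, 's, 'a) fo_struct \<Rightarrow> bool" where
  "transitive_one_point_extension L M z L' M' \<longleftrightarrow>
     one_point_extension L M z L' M' \<and>
     (\<forall>x\<in>univ M'. \<forall>y\<in>univ M'. \<exists>g\<in>Aut L' M'. g x = y)"

section \<open>Generic structures\<close>

definition generated :: "('f, 'r) lang \<Rightarrow> ('f, 'r, 'a) fo_struct \<Rightarrow> 'a set \<Rightarrow> 'a set" where
  "generated L M X = \<Inter>{B. X \<subseteq> B \<and> B \<subseteq> univ M \<and> fun_closed L M B}"

definition substructure :: "('f, 'r, 'a) fo_struct \<Rightarrow> 'a set \<Rightarrow> ('f, 'r, 'a) fo_struct" where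
  "substructure M A = \<lparr>univ = A, funs = funs M, rels = (\<lambda>r xs. rels M r xs \<and> set xs \<subseteq> A)\<rparr>"

definition finitely_generated :: "('f, 'r) lang \<Rightarrow> ('f, 'r, 'a) fo_struct \<Rightarrow> bool" where
  "finitely_generated L M \<longleftrightarrow> (\<exists>X. finite X \<and> X \<subseteq> univ M \<and> generated L M X = univ M)"

definition ultrahomogeneous :: "('f, 'r) lang \<Rightarrow> ('f, 'r, 'a) fo_struct \<Rightarrow> bool" where
  "ultrahomogeneous L M \<longleftrightarrow>
     (\<forall>X Y h. finite X \<longrightarrow> X \<subseteq> univ M \<longrightarrow> finite Y \<longrightarrow> Y \<subseteq> univ M \<longrightarrow>
        isomorphism L (substructure M (generated L M X)) (substructure M (generated L M Y)) h \<longrightarrow>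
        (\<exists>g\<in>Aut L M. \<forall>x\<in>generated L M X. g x = h x))"

text \<open>Isomorphism-closed classes of finitely generated structures are given by their members
  with universe in \<^typ>\<open>nat\<close>. For countable languages this is no restriction, since finitely
  generated structures are then countable.\<close>

definition age :: "('f, 'r) lang \<Rightarrow> ('f, 'r, 'a) fo_struct \<Rightarrow> ('f, 'r, nat) fo_struct set" where
  "age L M = {A. is_structure L A \<and> finitely_generated L A \<and> (\<exists>h. embedding L A M h)}"

definition generic ::
  "('f, 'r) lang \<Rightarrow> ('f, 'r, nat) fo_struct set \<Rightarrow> ('f, 'r, 'a) fo_struct \<Rightarrow> bool" where
  "generic L F M \<longleftrightarrow>
     is_structure L M \<and> countable (univ M) \<and> ultrahomogeneous L M \<and> age L M = F"

section \<open>Hypergraphs\<close>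

text \<open>HOL types are nonempty, so \<^typ>\<open>unit\<close> serves as the type of function symbols although
  the language contains none.\<close>

definition hyp_lang :: "nat \<Rightarrow> (unit, unit) lang" where
  "hyp_lang k = \<lparr>fsyms = {}, farity = (\<lambda>_. 0), rsyms = {()}, rarity = (\<lambda>_. k)\<rparr>"

type_synonym 'a hyp = "(unit, unit, 'a) fo_struct"

definition hyp :: "'a set \<Rightarrow> ('a list \<Rightarrow> bool) \<Rightarrow> 'a hyp" where
  "hyp G R = \<lparr>univ = G, funs = (\<lambda>_ _. undefined), rels = (\<lambda>_. R)\<rparr>"

definition hypergraph :: "nat \<Rightarrow> 'a hyp \<Rightarrow> bool" where
  "hypergraph k M \<longleftrightarrow>
     is_structure (hyp_lang k) M \<and>
     (\<forall>xs\<in>tuples k (univ M). \<forall>p. p permutes {..<k} \<longrightarrow>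
        (rels M () (permute_list p xs) \<longleftrightarrow> rels M () xs)) \<and>
     (\<forall>xs. rels M () xs \<longrightarrow> distinct xs)"

definition hyperedge :: "'a hyp \<Rightarrow> 'a set \<Rightarrow> bool" where
  "hyperedge M T \<longleftrightarrow> (\<exists>xs. set xs = T \<and> rels M () xs)"

definition even_hypergraph :: "nat \<Rightarrow> 'a hyp \<Rightarrow> bool" where
  "even_hypergraph k M \<longleftrightarrow>
     hypergraph k M \<and>
     (\<forall>S. S \<subseteq> univ M \<and> card S = k + 1 \<longrightarrow>
        even (card {T. T \<subseteq> S \<and> card T = k \<and> hyperedge M T}))"

definition generic_hypergraph :: "nat \<Rightarrow> 'a hyp \<Rightarrow> bool" where
  "generic_hypergraph k M \<longleftrightarrow>
     generic (hyp_lang k) {A. hypergraph k A \<and> finite (univ A)} M"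

definition generic_even_hypergraph :: "nat \<Rightarrow> 'a hyp \<Rightarrow> bool" where
  "generic_even_hypergraph k M \<longleftrightarrow>
     generic (hyp_lang k) {A. even_hypergraph k A \<and> finite (univ A)} M"

end

theory Submission
  imports Defs
begin

text \<open>
  The parity condition at \<open>insert z T\<close> forces \<open>T\<close> (with \<open>z \<notin> T\<close>) to be an edge of the extension
  iff it contains an odd number of edges of \<open>G\<close>; this defines an even hypergraph because each
  \<open>k\<close>-subset of a \<open>(k + 2)\<close>-set lies in exactly two of its \<open>(k + 1)\<close>-subsets. By the same parity
  condition an even hypergraph is determined by its link at any vertex, so finite even hypergraphs embed by
  sending a vertex to \<open>z\<close> and its link into \<open>G\<close>, and automorphisms of \<open>G\<close> are automorphisms of the
  extension. The extension property of \<open>G\<close> lets every finite partial isomorphism of the extension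
  be prolonged by one point, and a back-and-forth argument gives ultrahomogeneity. Transitivity
  follows since all one-point substructures are isomorphic.
\<close>

text \<open>Partial isomorphisms expressed on edge sets. The domain \<open>X\<close> is a parameter,
  so the same notion covers embeddings, isomorphisms between finite substructures and
  automorphisms.\<close>

definition edge_iso :: "nat \<Rightarrow> ('a set \<Rightarrow> bool) \<Rightarrow> ('b set \<Rightarrow> bool) \<Rightarrow> 'a set \<Rightarrow> ('a \<Rightarrow> 'b) \<Rightarrow> bool" where
  "edge_iso k E F X h \<longleftrightarrow> inj_on h X \<and> (\<forall>T\<subseteq>X. card T = k \<longrightarrow> (E T \<longleftrightarrow> F (h ` T)))"

section \<open>Hypergraphs in terms of their hyperedges\<close>

lemma hyp_lang_simps [simp]:
  "fsyms (hyp_lang k) = {}" "rsyms (hyp_lang k) = {()}" "rarity (hyp_lang k) r = k"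
  by (simp_all add: hyp_lang_def)

lemma hyp_simps [simp]: "univ (hyp G R) = G" "rels (hyp G R) r = R"
  by (simp_all add: hyp_def)

lemma is_structure_hyp_lang:
  "is_structure (hyp_lang k) M \<longleftrightarrow> (\<forall>xs. rels M () xs \<longrightarrow> xs \<in> tuples k (univ M))"
  by (simp add: is_structure_def fun_closed_def)

text \<open>Two repetition-free enumerations of one set differ by a permutation of positions, so
  symmetry makes the relation a property of the underlying set. From here on edges replace
  tuples.\<close>

lemma rels_iff_hyperedge:
  assumes "hypergraph k M"
  shows "rels M () xs \<longleftrightarrow> distinct xs \<and> hyperedge M (set xs)"
proof
  assume "rels M () xs"
  with assms show "distinct xs \<and> hyperedge M (set xs)"
    by (auto simp: hypergraph_def hyperedge_def)
next
  assume *: "distinct xs \<and> hyperedge M (set xs)"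
  then obtain ys where ys: "set ys = set xs" "rels M () ys"
    by (auto simp: hyperedge_def)
  with assms have "distinct ys" and t: "ys \<in> tuples k (univ M)"
    by (auto simp: hypergraph_def is_structure_hyp_lang)
  with * ys have "mset xs = mset ys"
    by (simp add: set_eq_iff_mset_eq_distinct)
  then obtain p where p: "p permutes {..<length ys}" "permute_list p ys = xs"
    by (rule mset_eq_permutation)
  with t have "p permutes {..<k}" by (simp add: tuples_def)
  with p t ys assms show "rels M () xs" by (auto simp: hypergraph_def)
qed

lemma hyperedgeD:
  assumes "hypergraph k M" "hyperedge M T"
  shows "T \<subseteq> univ M" "card T = k" "finite T"
proof -
  from assms obtain xs where xs: "set xs = T" "rels M () xs" by (auto simp: hyperedge_def)
  with assms(1) have "distinct xs" "xs \<in> tuples k (univ M)"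
    by (auto simp: hypergraph_def is_structure_hyp_lang)
  with xs show "T \<subseteq> univ M" "card T = k" "finite T"
    by (auto simp: tuples_def distinct_card)
qed

text \<open>The device for building hypergraphs from a prescribed family of \<open>k\<close>-sets:
  it yields the one-point prolongations, the links and the even extension below.\<close>

lemma hypergraph_of_edges:
  assumes "\<And>T. E T \<Longrightarrow> T \<subseteq> G \<and> finite T \<and> card T = k"
  defines "M \<equiv> hyp G (\<lambda>xs. distinct xs \<and> E (set xs))"
  shows "hypergraph k M" "hyperedge M = E"
proof -
  show "hypergraph k M"
    unfolding hypergraph_def
  proof (intro conjI ballI allI impI)
    show "is_structure (hyp_lang k) M"
      using assms(1) by (fastforce simp: is_structure_hyp_lang M_def tuples_def distinct_card)
  next
    fix xs p assume "xs \<in> tuples k (univ M)" "p permutes {..<k}"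
    then show "rels M () (permute_list p xs) = rels M () xs"
      by (auto simp: M_def tuples_def)
  next
    fix xs assume "rels M () xs"
    then show "distinct xs" by (simp add: M_def)
  qed
  show "hyperedge M = E"
  proof
    fix T
    have "\<exists>xs. set xs = T \<and> distinct xs" if "E T"
      using assms(1)[OF that] finite_distinct_list by blast
    then show "hyperedge M T = E T"
      by (auto simp: hyperedge_def M_def)
  qed
qed

lemma embedding_hypergraph_iff:
  assumes M: "hypergraph k M" and N: "hypergraph k N"
  shows "embedding (hyp_lang k) M N h \<longleftrightarrow>
    h ` univ M \<subseteq> univ N \<and> edge_iso k (hyperedge M) (hyperedge N) (univ M) h"
proof -
  have "(\<forall>xs\<in>tuples k (univ M). rels M () xs = rels N () (map h xs)) \<longleftrightarrow>
    (\<forall>T\<subseteq>univ M. card T = k \<longrightarrow> hyperedge M T = hyperedge N (h ` T))" (is "?l \<longleftrightarrow> ?r")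
    if inj: "inj_on h (univ M)"
  proof
    assume l: ?l
    show ?r
    proof (intro allI impI)
      fix T assume T: "T \<subseteq> univ M" "card T = k"
      show "hyperedge M T = hyperedge N (h ` T)"
      proof (cases "finite T")
        case True
        then obtain xs where xs: "set xs = T" "distinct xs" using finite_distinct_list by blast
        with T have "xs \<in> tuples k (univ M)" by (auto simp: tuples_def distinct_card)
        moreover have "distinct (map h xs)"
          using xs T inj by (auto simp: distinct_map intro: inj_on_subset)
        ultimately show ?thesis
          using l xs rels_iff_hyperedge[OF M] rels_iff_hyperedge[OF N] by auto
      next
        \<comment> \<open>An infinite set has \<open>card\<close> 0, so this case arises for
          \<open>k = 0\<close>; then neither \<open>T\<close> nor its image is an edge, since edges
          are finite.\<close>
        case False
        moreover have "infinite (h ` T)"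
          using False inj T finite_imageD inj_on_subset by blast
        ultimately show ?thesis using hyperedgeD(3)[OF M] hyperedgeD(3)[OF N] by blast
      qed
    qed
  next
    assume r: ?r
    show ?l
    proof
      fix xs assume xs: "xs \<in> tuples k (univ M)"
      then have sub: "set xs \<subseteq> univ M" and len: "length xs = k" by (auto simp: tuples_def)
      have "distinct (map h xs) = distinct xs"
        using inj sub by (auto simp: distinct_map intro: inj_on_subset)
      moreover have "hyperedge M (set xs) = hyperedge N (h ` set xs)" if "distinct xs"
        using r sub len that by (auto simp: distinct_card)
      ultimately show "rels M () xs = rels N () (map h xs)"
        by (auto simp: rels_iff_hyperedge[OF M] rels_iff_hyperedge[OF N])
    qed
  qed
  then show ?thesis by (auto simp: embedding_def edge_iso_def)
qed

section \<open>Substructures, automorphisms and ultrahomogeneity in terms of edges\<close>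

lemma hyperedge_substructure:
  "hyperedge (substructure M X) T \<longleftrightarrow> hyperedge M T \<and> T \<subseteq> X"
  by (auto simp: hyperedge_def substructure_def)

lemma hypergraph_substructure:
  assumes "hypergraph k M" "X \<subseteq> univ M"
  shows "hypergraph k (substructure M X)"
  unfolding hypergraph_def
proof (intro conjI ballI allI impI)
  show "is_structure (hyp_lang k) (substructure M X)"
    using assms by (simp add: hypergraph_def is_structure_hyp_lang substructure_def tuples_def)
next
  fix xs p assume xs: "xs \<in> tuples k (univ (substructure M X))" and p: "p permutes {..<k}"
  then have "set (permute_list p xs) = set xs" by (simp add: tuples_def)
  moreover have "xs \<in> tuples k (univ M)"
    using xs assms(2) by (auto simp: tuples_def substructure_def)
  then have "rels M () (permute_list p xs) = rels M () xs"
    using assms(1) p by (simp add: hypergraph_def)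
  ultimately show "rels (substructure M X) () (permute_list p xs) = rels (substructure M X) () xs"
    by (simp add: substructure_def)
next
  fix xs assume "rels (substructure M X) () xs"
  then show "distinct xs" using assms(1) by (simp add: hypergraph_def substructure_def)
qed

lemma edge_iso_cong:
  assumes "\<And>T. T \<subseteq> X \<Longrightarrow> card T = k \<Longrightarrow> E T = E' T"
    and "\<And>T. T \<subseteq> h ` X \<Longrightarrow> F T = F' T" and "\<And>x. x \<in> X \<Longrightarrow> h x = h' x"
  shows "edge_iso k E F X h = edge_iso k E' F' X h'"
proof -
  have "F (h ` T) = F' (h' ` T)" if "T \<subseteq> X" for T
  proof -
    have "h ` T = h' ` T" using assms(3) that by (intro image_cong) auto
    moreover have "F (h ` T) = F' (h ` T)" using assms(2) that by blast
    ultimately show ?thesis by simp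
  qed
  moreover have "inj_on h X = inj_on h' X" using assms(3) by (rule inj_on_cong)
  ultimately show ?thesis unfolding edge_iso_def using assms(1) by simp
qed

lemma isomorphism_substructure_iff:
  assumes "hypergraph k M" "X \<subseteq> univ M" "Y \<subseteq> univ M"
  shows "isomorphism (hyp_lang k) (substructure M X) (substructure M Y) h \<longleftrightarrow>
    h ` X = Y \<and> edge_iso k (hyperedge M) (hyperedge M) X h"
proof -
  have "edge_iso k (hyperedge (substructure M X)) (hyperedge (substructure M Y)) X h =
      edge_iso k (hyperedge M) (hyperedge M) X h" if "h ` X = Y"
    using that by (intro edge_iso_cong) (auto simp: hyperedge_substructure)
  then show ?thesis
    using embedding_hypergraph_iff[OF hypergraph_substructure[OF assms(1,2)]
        hypergraph_substructure[OF assms(1,3)]]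
    by (auto simp: isomorphism_def substructure_def)
qed

lemma Aut_hypergraph_iff:
  assumes "hypergraph k M"
  shows "g \<in> Aut (hyp_lang k) M \<longleftrightarrow>
    g permutes univ M \<and> edge_iso k (hyperedge M) (hyperedge M) (univ M) g"
  using permutes_image[of g "univ M"]
  by (auto simp: Aut_def isomorphism_def embedding_hypergraph_iff[OF assms assms])

lemma generated_hyp_lang: "X \<subseteq> univ M \<Longrightarrow> generated (hyp_lang k) M X = X"
  by (auto simp: generated_def fun_closed_def)

lemma finitely_generated_hyp_lang: "finitely_generated (hyp_lang k) M \<longleftrightarrow> finite (univ M)"
  using generated_hyp_lang unfolding finitely_generated_def by fastforce

lemma ultrahomogeneous_hypergraph_iff:
  assumes "hypergraph k M"
  shows "ultrahomogeneous (hyp_lang k) M \<longleftrightarrow>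
    (\<forall>X h. finite X \<longrightarrow> X \<subseteq> univ M \<longrightarrow> h ` X \<subseteq> univ M \<longrightarrow>
      edge_iso k (hyperedge M) (hyperedge M) X h \<longrightarrow>
      (\<exists>g\<in>Aut (hyp_lang k) M. \<forall>x\<in>X. g x = h x))"
  (is "?l \<longleftrightarrow> ?r")
proof
  assume l: ?l
  show ?r
  proof (intro allI impI)
    fix X h assume X: "finite X" "X \<subseteq> univ M" "h ` X \<subseteq> univ M"
      "edge_iso k (hyperedge M) (hyperedge M) X h"
    then have "isomorphism (hyp_lang k) (substructure M X) (substructure M (h ` X)) h"
      by (simp add: isomorphism_substructure_iff[OF assms])
    with X l[unfolded ultrahomogeneous_def, rule_format, of X "h ` X" h]
    show "\<exists>g\<in>Aut (hyp_lang k) M. \<forall>x\<in>X. g x = h x"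
      by (simp add: generated_hyp_lang)
  qed
next
  assume r: ?r
  show ?l
    unfolding ultrahomogeneous_def
  proof (intro allI impI)
    fix X Y h assume X: "finite X" "X \<subseteq> univ M" "finite Y" "Y \<subseteq> univ M"
      "isomorphism (hyp_lang k) (substructure M (generated (hyp_lang k) M X))
        (substructure M (generated (hyp_lang k) M Y)) h"
    then have "h ` X = Y" "edge_iso k (hyperedge M) (hyperedge M) X h"
      by (simp_all add: generated_hyp_lang isomorphism_substructure_iff[OF assms])
    with X r show "\<exists>g\<in>Aut (hyp_lang k) M. \<forall>x\<in>generated (hyp_lang k) M X. g x = h x"
      by (simp add: generated_hyp_lang)
  qed
qed

text \<open>A failure of symmetry or irreflexivity would be visible in a finite substructure.\<close>

lemma generic_hypergraphD:
  assumes "generic_hypergraph k M"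
  shows "hypergraph k M" "countable (univ M)"
proof -
  show "countable (univ M)" using assms by (simp add: generic_hypergraph_def generic_def)
  have st: "is_structure (hyp_lang k) M" and
    age: "age (hyp_lang k) M = {A. hypergraph k A \<and> finite (univ A)}"
    using assms by (auto simp: generic_hypergraph_def generic_def)
  have loc: "(\<forall>p. p permutes {..<k} \<longrightarrow> rels M () (permute_list p xs) = rels M () xs) \<and>
     (rels M () xs \<longrightarrow> distinct xs)" if xs: "xs \<in> tuples k (univ M)" for xs
  proof -
    \<comment> \<open>Members of the age live on natural numbers, so the substructure on the entries
      of \<open>xs\<close> is transported to codes: \<open>b\<close> encodes and \<open>c\<close>
      decodes.\<close>
    define c where "c = from_nat_into (set xs)"
    define b where "b = to_nat_on (set xs)"
    have cb: "c (b x) = x" if "x \<in> set xs" for x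
      using that by (simp add: c_def b_def countable_finite)
    define A :: "nat hyp" where
      "A = hyp (b ` set xs) (\<lambda>ys. ys \<in> tuples k (b ` set xs) \<and> rels M () (map c ys))"
    have "is_structure (hyp_lang k) A" by (simp add: A_def is_structure_hyp_lang)
    moreover have "embedding (hyp_lang k) A M c"
      using xs cb by (auto simp: embedding_def A_def tuples_def inj_on_def)
    moreover have "finite (univ A)" by (simp add: A_def)
    ultimately have "A \<in> age (hyp_lang k) M"
      by (auto simp: age_def finitely_generated_hyp_lang)
    then have A: "hypergraph k A" using age by simp
    have len: "length xs = k" using xs by (simp add: tuples_def)
    have map_cb: "map c (map b ys) = ys" if "set ys \<subseteq> set xs" for ys
      using that cb by (simp add: subset_iff map_idI)
    have "rels M () xs = rels A () (map b xs)"
      using map_cb[of xs] len by (simp add: A_def tuples_def)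
    moreover have "rels M () (permute_list p xs) = rels A () (permute_list p (map b xs))"
      if "p permutes {..<k}" for p
    proof -
      have "set (permute_list p xs) = set xs" using that len by simp
      then show ?thesis
        using map_cb[of "permute_list p xs"] len that
        by (simp add: A_def tuples_def permute_list_map)
    qed
    moreover have "map b xs \<in> tuples k (univ A)" using len by (auto simp: A_def tuples_def)
    ultimately show ?thesis using A by (auto simp: hypergraph_def distinct_map)
  qed
  with st show "hypergraph k M" by (auto simp: hypergraph_def is_structure_hyp_lang)
qed

section \<open>The extension property\<close>

text \<open>Adjoin to a copy of \<open>S\<close> one new point with link \<open>D\<close>. This
  finite hypergraph embeds into \<open>M\<close>, and ultrahomogeneity moves the embedded copy of
  \<open>S\<close> back onto \<open>S\<close>; the new point lands on \<open>y\<close>.\<close>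

lemma generic_hypergraph_extension:
  assumes gen: "generic_hypergraph k M" and S: "finite S" "S \<subseteq> univ M"
  shows "\<exists>y\<in>univ M - S. \<forall>P\<subseteq>S. card P + 1 = k \<longrightarrow> (hyperedge M (insert y P) \<longleftrightarrow> D P)"
proof -
  have M: "hypergraph k M" using generic_hypergraphD[OF gen] by simp
  from gen have age: "age (hyp_lang k) M = {A. hypergraph k A \<and> finite (univ A)}"
    and uh: "ultrahomogeneous (hyp_lang k) M"
    by (auto simp: generic_hypergraph_def generic_def)
  define n where "n = card S"
  obtain b where b: "bij_betw b S {..<n}"
    using S(1) ex_bij_betw_finite_nat[of S] by (auto simp: n_def atLeast0LessThan)
  define c where "c = inv_into S b"
  have cb: "c ` b ` P = P" if "P \<subseteq> S" for P
    using that b unfolding c_def by (simp add: bij_betw_def inv_into_image_cancel)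
  \<comment> \<open>The codes below \<open>n\<close> stand for \<open>S\<close>, with edges copied
    from \<open>M\<close>; \<open>n\<close> itself is the new point, whose edges are dictated by
    \<open>D\<close>.\<close>
  define E where "E T \<longleftrightarrow> T \<subseteq> {..n} \<and> card T = k \<and>
    (if n \<in> T then D (c ` (T - {n})) else hyperedge M (c ` T))" for T
  define A where "A = hyp {..n} (\<lambda>xs. distinct xs \<and> E (set xs))"
  have "T \<subseteq> {..n} \<and> finite T \<and> card T = k" if "E T" for T
    using that finite_subset by (auto simp: E_def)
  then have A: "hypergraph k A" "hyperedge A = E"
    unfolding A_def using hypergraph_of_edges[of E "{..n}" k] by auto
  have uA: "univ A = {..n}" by (simp add: A_def)
  with A have "A \<in> age (hyp_lang k) M" by (simp add: age)
  then obtain h where "embedding (hyp_lang k) A M h" by (auto simp: age_def)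
  then have h: "h ` {..n} \<subseteq> univ M" "inj_on h {..n}"
    and hE: "\<And>T. T \<subseteq> {..n} \<Longrightarrow> card T = k \<Longrightarrow> E T \<longleftrightarrow> hyperedge M (h ` T)"
    using A(2) uA by (auto simp: embedding_hypergraph_iff[OF A(1) M] edge_iso_def)
  have bS: "b x < n" if "x \<in> S" for x using b that by (auto simp: bij_betw_def)
  have binj: "inj_on b S" using b by (simp add: bij_betw_def)
  \<comment> \<open>The embedded copy of \<open>S\<close> is joined to \<open>S\<close> by a finite
    partial isomorphism. It extends to an automorphism \<open>g\<close>, and \<open>y\<close> is the
    preimage of \<open>h n\<close> under \<open>g\<close>.\<close>
  have "edge_iso k (hyperedge M) (hyperedge M) S (h \<circ> b)"
    unfolding edge_iso_def
  proof (intro conjI allI impI)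
    show "inj_on (h \<circ> b) S"
      using binj h(2) bS by (auto intro!: comp_inj_on intro: inj_on_subset less_imp_le)
    fix T assume T: "T \<subseteq> S" "card T = k"
    have "card (b ` T) = k" "b ` T \<subseteq> {..n}" "n \<notin> b ` T"
      using T bS card_image[OF inj_on_subset[OF binj T(1)]] by (auto simp: less_imp_le)
    then show "hyperedge M T = hyperedge M ((h \<circ> b) ` T)"
      using hE[of "b ` T"] cb[OF T(1)] by (simp add: E_def image_comp)
  qed
  moreover have "(h \<circ> b) ` S \<subseteq> univ M" using h(1) bS by (auto simp: less_imp_le)
  ultimately have "\<exists>g\<in>Aut (hyp_lang k) M. \<forall>x\<in>S. g x = (h \<circ> b) x"
    using uh[unfolded ultrahomogeneous_hypergraph_iff[OF M]] S by blast
  then obtain g where g: "g \<in> Aut (hyp_lang k) M" and gh: "\<And>x. x \<in> S \<Longrightarrow> g x = h (b x)"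
    by auto
  then have gp: "g permutes univ M"
    and gE: "\<And>T. T \<subseteq> univ M \<Longrightarrow> card T = k \<Longrightarrow> hyperedge M T = hyperedge M (g ` T)"
    by (auto simp: Aut_hypergraph_iff[OF M] edge_iso_def)
  have "h n \<in> univ M" using h(1) by auto
  then obtain y where y: "y \<in> univ M" "g y = h n" using permutes_image[OF gp] by force
  have "y \<notin> S"
  proof
    assume "y \<in> S"
    then have "h (b y) = h n" "b y < n" using gh y bS by auto
    with h(2) show False by (auto simp: inj_on_def)
  qed
  moreover have "hyperedge M (insert y P) \<longleftrightarrow> D P" if P: "P \<subseteq> S" "card P + 1 = k" for P
  proof -
    have fP: "finite P" using P S finite_subset by auto
    have "y \<notin> P" using \<open>y \<notin> S\<close> P by auto
    have nP: "n \<notin> b ` P" "b ` P \<subseteq> {..n}" using P bS by (auto simp: less_imp_le)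
    have "hyperedge M (insert y P) \<longleftrightarrow> hyperedge M (g ` insert y P)"
      using y P S \<open>y \<notin> P\<close> fP by (intro gE) auto
    also have "g ` insert y P = h ` insert n (b ` P)"
      using y gh P by (auto simp: image_iff subset_iff)
    also have "hyperedge M \<dots> \<longleftrightarrow> E (insert n (b ` P))"
      using nP fP P card_image[OF inj_on_subset[OF binj P(1)]] by (intro hE[symmetric]) auto
    also have "\<dots> \<longleftrightarrow> D P"
      using nP fP P cb[OF P(1)] card_image[OF inj_on_subset[OF binj P(1)]]
      by (auto simp: E_def)
    finally show ?thesis .
  qed
  ultimately show ?thesis using y by blast
qed

section \<open>Back and forth\<close>

text \<open>Stages are relations rather than functions, which treats domain and range alike. The
  last conclusion says that each finite part of \<open>p\<close> lies in one admissible stage, so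
  that conditions on finite sets pass to the limit.\<close>

lemma back_and_forth:
  assumes "countable U" and "I r0"
    and forth: "\<And>r x. I r \<Longrightarrow> x \<in> U \<Longrightarrow> \<exists>y. I (insert (x, y) r)"
    and bwd: "\<And>r y. I r \<Longrightarrow> y \<in> U \<Longrightarrow> \<exists>x. I (insert (x, y) r)"
    and inj: "\<And>r x y x' y'. I r \<Longrightarrow> (x, y) \<in> r \<Longrightarrow> (x', y') \<in> r \<Longrightarrow> x = x' \<longleftrightarrow> y = y'"
    and sub: "\<And>r. I r \<Longrightarrow> r \<subseteq> U \<times> U"
  shows "\<exists>p. bij_betw p U U \<and> (\<forall>(x, y)\<in>r0. p x = y) \<and>
    (\<forall>T. finite T \<longrightarrow> T \<subseteq> U \<longrightarrow> (\<exists>r. I r \<and> (\<forall>x\<in>T. (x, p x) \<in> r)))"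
proof (cases "U = {}")
  case True
  with sub[OF \<open>I r0\<close>] \<open>I r0\<close> show ?thesis by (auto simp: bij_betw_def)
next
  case False
  define e where "e = from_nat_into U"
  have eU: "e n \<in> U" for n unfolding e_def using from_nat_into[OF False] by simp
  have e_surj: "\<exists>n. e n = x" if "x \<in> U" for x
    unfolding e_def using from_nat_into_surj[OF \<open>countable U\<close> that] by auto
  \<comment> \<open>One round puts \<open>e n\<close> into both domain and range; running through
    the enumeration makes the union total and surjective.\<close>
  have "\<exists>r'. I r' \<and> r \<subseteq> r' \<and> e n \<in> Domain r' \<and> e n \<in> Range r'" if Ir: "I r" for r n
  proof -
    obtain y where "I (insert (e n, y) r)" using forth[OF Ir eU] by blast
    then obtain x where "I (insert (x, e n) (insert (e n, y) r))" using bwd[OF _ eU] by blast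
    then show ?thesis by blast
  qed
  then obtain s where s: "\<And>r n. I r \<Longrightarrow> I (s r n) \<and> r \<subseteq> s r n \<and> e n \<in> Domain (s r n) \<and> e n \<in> Range (s r n)"
    by metis
  define q where "q = rec_nat r0 (\<lambda>n r. s r n)"
  have q0: "q 0 = r0" and qS: "q (Suc n) = s (q n) n" for n by (simp_all add: q_def)
  have qI: "I (q n)" for n by (induction n) (auto simp: q0 qS \<open>I r0\<close> s)
  have mono: "q m \<subseteq> q n" if "m \<le> n" for m n
    using that by (rule lift_Suc_mono_le[rotated]) (use s qI qS in auto)
  define Q where "Q = (\<Union>n. q n)"
  have Qinj: "x = x' \<longleftrightarrow> y = y'" if "(x, y) \<in> Q" "(x', y') \<in> Q" for x y x' y'
  proof -
    from that obtain m n where "(x, y) \<in> q m" "(x', y') \<in> q n" by (auto simp: Q_def)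
    then have "(x, y) \<in> q (max m n)" "(x', y') \<in> q (max m n)"
      using mono[of m "max m n"] mono[of n "max m n"] by auto
    then show ?thesis using inj[OF qI] by blast
  qed
  have QU: "Q \<subseteq> U \<times> U" using sub qI by (force simp: Q_def)
  have dom: "\<exists>y. (x, y) \<in> Q" and ran: "\<exists>y. (y, x) \<in> Q" if xU: "x \<in> U" for x
  proof -
    obtain n where "e n = x" using e_surj[OF xU] by blast
    with s[OF qI, of n n] have "x \<in> Domain (q (Suc n))" "x \<in> Range (q (Suc n))"
      by (auto simp: qS)
    then show "\<exists>y. (x, y) \<in> Q" "\<exists>y. (y, x) \<in> Q" unfolding Q_def by blast+
  qed
  from dom obtain p where p: "\<And>x. x \<in> U \<Longrightarrow> (x, p x) \<in> Q" by metis
  have pQ: "p x = y" if "(x, y) \<in> Q" for x y using that QU Qinj[OF that p] by auto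
  have "bij_betw p U U"
    unfolding bij_betw_def
  proof
    show "inj_on p U" using Qinj p by (metis inj_onI)
    show "p ` U = U"
    proof
      show "p ` U \<subseteq> U" using p QU by auto
      show "U \<subseteq> p ` U"
      proof
        fix y assume "y \<in> U"
        then obtain x where "(x, y) \<in> Q" using ran by blast
        then show "y \<in> p ` U" using pQ QU by blast
      qed
    qed
  qed
  moreover have "\<forall>(x, y)\<in>r0. p x = y" using pQ q0 by (auto simp: Q_def)
  moreover have "\<exists>r. I r \<and> (\<forall>x\<in>T. (x, p x) \<in> r)" if "finite T" "T \<subseteq> U" for T
  proof -
    \<comment> \<open>The stages increase, so finitely many pairs of the union already occur in a
      common stage.\<close>
    have "\<exists>n. \<forall>x\<in>T. (x, p x) \<in> q n"
      using that
    proof (induction T rule: finite_induct)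
      case (insert x T)
      then obtain n where n: "\<forall>x\<in>T. (x, p x) \<in> q n" by auto
      obtain m where m: "(x, p x) \<in> q m" using p insert.prems by (auto simp: Q_def)
      show ?case
        using n m mono[of m "max m n"] mono[of n "max m n"]
        by (intro exI[of _ "max m n"]) auto
    qed simp
    then show ?thesis using qI by blast
  qed
  ultimately show ?thesis by blast
qed

lemma edge_iso_inv_into:
  assumes "edge_iso k E F X h"
  shows "edge_iso k F E (h ` X) (inv_into X h)"
  unfolding edge_iso_def
proof (intro conjI allI impI)
  show "inj_on (inv_into X h) (h ` X)" by (rule inj_on_inv_into) simp
  fix T assume T: "T \<subseteq> h ` X" "card T = k"
  have "inv_into X h ` T \<subseteq> X" using T by (auto intro: inv_into_into)
  moreover have "h ` inv_into X h ` T = T" using T by (simp add: image_inv_into_cancel)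
  moreover have "card (inv_into X h ` T) = card T"
    using T by (intro card_image inj_on_inv_into)
  ultimately show "F T = E (inv_into X h ` T)"
    using assms T unfolding edge_iso_def by metis
qed

text \<open>Prolonging the domain suffices: the inverse of a finite partial isomorphism is again
  one, so the back step is the forth step for the converse relation.\<close>

lemma ultrahomogeneous_of_forth:
  assumes M: "hypergraph k M" and k: "0 < k" and count: "countable (univ M)"
    and forth: "\<And>X h x. finite X \<Longrightarrow> X \<subseteq> univ M \<Longrightarrow> h ` X \<subseteq> univ M \<Longrightarrow>
        edge_iso k (hyperedge M) (hyperedge M) X h \<Longrightarrow> x \<in> univ M - X \<Longrightarrow>
        \<exists>y\<in>univ M. edge_iso k (hyperedge M) (hyperedge M) (insert x X) (h(x := y))"
  shows "ultrahomogeneous (hyp_lang k) M"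
  unfolding ultrahomogeneous_hypergraph_iff[OF M]
proof (intro allI impI)
  fix X h assume X: "finite X" "X \<subseteq> univ M" "h ` X \<subseteq> univ M"
    "edge_iso k (hyperedge M) (hyperedge M) X h"
  \<comment> \<open>Passing to graphs forgets the values of \<open>h\<close> outside
    \<open>X\<close>.\<close>
  define gr :: "'a set \<Rightarrow> ('a \<Rightarrow> 'a) \<Rightarrow> ('a \<times> 'a) set" where "gr X h = (\<lambda>x. (x, h x)) ` X" for X h
  define J where "J X h \<longleftrightarrow> finite X \<and> X \<subseteq> univ M \<and> h ` X \<subseteq> univ M \<and>
    edge_iso k (hyperedge M) (hyperedge M) X h" for X h
  define I where "I r \<longleftrightarrow> (\<exists>X h. r = gr X h \<and> J X h)" for r
  have I_forth: "\<exists>y. I (insert (x, y) r)" if r: "I r" and x: "x \<in> univ M" for r x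
  proof -
    from r obtain X h where Xh: "r = gr X h" "J X h" by (auto simp: I_def)
    show ?thesis
    proof (cases "x \<in> X")
      case True
      then have "insert (x, h x) r = r" using Xh by (auto simp: gr_def)
      then show ?thesis using r by metis
    next
      case False
      then obtain y where y: "y \<in> univ M"
        "edge_iso k (hyperedge M) (hyperedge M) (insert x X) (h(x := y))"
        using forth[of X h x] Xh x by (auto simp: J_def)
      have "J (insert x X) (h(x := y))" using Xh x y by (auto simp: J_def)
      moreover have "insert (x, y) r = gr (insert x X) (h(x := y))"
        using Xh False by (auto simp: gr_def)
      ultimately show ?thesis by (auto simp: I_def)
    qed
  qed
  have I_conv: "I (r\<inverse>)" if "I r" for r
  proof -
    from that obtain X h where Xh: "r = gr X h" "J X h" by (auto simp: I_def)
    then have inj: "inj_on h X" by (simp add: J_def edge_iso_def)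
    have "J (h ` X) (inv_into X h)"
      using Xh edge_iso_inv_into[of k _ _ X h] inj by (auto simp: J_def)
    moreover have "r\<inverse> = gr (h ` X) (inv_into X h)"
      using inj Xh by (auto simp: gr_def image_iff)
    ultimately show ?thesis by (auto simp: I_def)
  qed
  have I_back: "\<exists>x. I (insert (x, y) r)" if r: "I r" and y: "y \<in> univ M" for r y
  proof -
    obtain x where "I (insert (y, x) (r\<inverse>))" using I_forth[OF I_conv[OF r] y] by blast
    then have "I ((insert (y, x) (r\<inverse>))\<inverse>)" by (rule I_conv)
    moreover have "(insert (y, x) (r\<inverse>))\<inverse> = insert (x, y) r" by auto
    ultimately show ?thesis by auto
  qed
  have "\<exists>p. bij_betw p (univ M) (univ M) \<and> (\<forall>(x, y)\<in>gr X h. p x = y) \<and>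
    (\<forall>T. finite T \<longrightarrow> T \<subseteq> univ M \<longrightarrow> (\<exists>r. I r \<and> (\<forall>x\<in>T. (x, p x) \<in> r)))"
  proof (rule back_and_forth[OF count])
    show "I (gr X h)" using X by (auto simp: I_def J_def)
    show "x = x' \<longleftrightarrow> y = y'" if "I r" "(x, y) \<in> r" "(x', y') \<in> r" for r x y x' y'
      using that by (auto simp: I_def J_def gr_def edge_iso_def inj_on_def)
    show "r \<subseteq> univ M \<times> univ M" if "I r" for r
      using that by (auto simp: I_def J_def gr_def)
  qed (use I_forth I_back in auto)
  then obtain p where p: "bij_betw p (univ M) (univ M)" "\<And>x. x \<in> X \<Longrightarrow> p x = h x"
    and pI: "\<And>T. finite T \<Longrightarrow> T \<subseteq> univ M \<Longrightarrow> \<exists>r. I r \<and> (\<forall>x\<in>T. (x, p x) \<in> r)"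
    by (auto simp: gr_def)
  \<comment> \<open>\<open>Aut\<close> asks for permutations that are the identity off the universe,
    whereas \<open>p\<close> is uncontrolled there.\<close>
  define g where "g x = (if x \<in> univ M then p x else x)" for x
  have "bij_betw g (univ M) (univ M)"
    using p(1) by (rule bij_betw_cong[THEN iffD1, rotated]) (simp add: g_def)
  then have g: "g permutes univ M" by (rule bij_imp_permutes) (simp add: g_def)
  have "hyperedge M T = hyperedge M (g ` T)" if T: "T \<subseteq> univ M" "card T = k" for T
  proof -
    \<comment> \<open>Here \<open>0 < k\<close> matters: it makes every set of cardinality
      \<open>k\<close> finite, hence contained in the domain of one stage.\<close>
    have "finite T" using T k card_ge_0_finite by blast
    then obtain r where r: "I r" "\<forall>x\<in>T. (x, p x) \<in> r" using pI T by blast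
    then obtain Y f where Y: "r = gr Y f" "J Y f" by (auto simp: I_def)
    have TY: "T \<subseteq> Y" "\<And>x. x \<in> T \<Longrightarrow> p x = f x" using r Y by (auto simp: gr_def)
    have "g ` T = f ` T" using TY T by (intro image_cong) (auto simp: g_def)
    moreover have "hyperedge M T = hyperedge M (f ` T)"
      using Y TY T by (simp add: J_def edge_iso_def)
    ultimately show ?thesis by simp
  qed
  then have "g \<in> Aut (hyp_lang k) M"
    using g by (auto simp: Aut_hypergraph_iff[OF M] edge_iso_def permutes_inj_on)
  moreover have "\<forall>x\<in>X. g x = h x" using p(2) X by (auto simp: g_def)
  ultimately show "\<exists>g\<in>Aut (hyp_lang k) M. \<forall>x\<in>X. g x = h x" by blast
qed

section \<open>Even hypergraphs\<close>

text \<open>A \<open>(k + 1)\<close>-subset of \<open>insert z T\<close> either omits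
  \<open>z\<close>, and then is \<open>T\<close>, or is \<open>insert z P\<close> for a
  \<open>k\<close>-subset \<open>P\<close> of \<open>T\<close>.\<close>

lemma card_subsets_insert:
  assumes "finite T" "card T = k + 1" "z \<notin> T"
  shows "card {Q. Q \<subseteq> insert z T \<and> card Q = k + 1 \<and> E Q} =
    (if E T then 1 else 0) + card {P. P \<subseteq> T \<and> card P = k \<and> E (insert z P)}"
proof -
  let ?A = "if E T then {T} else {}" and ?B = "{P. P \<subseteq> T \<and> card P = k \<and> E (insert z P)}"
  have "{Q. Q \<subseteq> insert z T \<and> card Q = k + 1 \<and> E Q} = ?A \<union> insert z ` ?B" (is "?L = ?R")
  proof
    show "?L \<subseteq> ?R"
    proof
      fix Q assume Q: "Q \<in> ?L"
      show "Q \<in> ?R"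
      proof (cases "z \<in> Q")
        case True
        have "Q - {z} \<in> ?B" using Q True by (auto simp: insert_absorb)
        moreover have "Q = insert z (Q - {z})" using True by blast
        ultimately show ?thesis by blast
      next
        case False
        then have "Q \<subseteq> T" using Q by auto
        then have "Q = T" using Q assms by (intro card_subset_eq) auto
        then show ?thesis using Q by simp
      qed
    qed
    have "card (insert z P) = k + 1" if "P \<subseteq> T" "card P = k" for P
      using that assms finite_subset[OF that(1)] by (auto simp: card_insert_if)
    then show "?R \<subseteq> ?L" using assms(2) by (auto split: if_splits)
  qed
  moreover have "card (insert z ` ?B) = card ?B"
    using assms(3) by (intro card_image inj_onI) (auto simp: insert_eq_iff)
  moreover have "card (?A \<union> insert z ` ?B) = card ?A + card (insert z ` ?B)"
    using assms by (intro card_Un_disjoint) auto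
  ultimately show ?thesis by simp
qed

text \<open>The parity condition on the \<open>(k + 2)\<close>-set \<open>insert z T\<close>, solved
  for the one subset that omits \<open>z\<close>: the link at \<open>z\<close> determines all
  remaining edges.\<close>

lemma even_hyperedge_iff:
  assumes "even_hypergraph (k + 1) M" "insert z T \<subseteq> univ M" "z \<notin> T" "card T = k + 1"
  shows "hyperedge M T \<longleftrightarrow> odd (card {P. P \<subseteq> T \<and> card P = k \<and> hyperedge M (insert z P)})"
proof -
  have "finite T" using assms(4) by (simp add: card_ge_0_finite)
  then have "even (card {Q. Q \<subseteq> insert z T \<and> card Q = k + 1 \<and> hyperedge M Q})"
    using assms by (simp add: even_hypergraph_def)
  then show ?thesis
    using card_subsets_insert[OF \<open>finite T\<close> assms(4,3), of "hyperedge M"] by (auto split: if_splits)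
qed

lemma card_subsets_image:
  assumes "inj_on h S" "\<And>T. T \<subseteq> S \<Longrightarrow> card T = k \<Longrightarrow> E T = F (h ` T)"
  shows "card {T. T \<subseteq> h ` S \<and> card T = k \<and> F T} = card {T. T \<subseteq> S \<and> card T = k \<and> E T}"
proof -
  have card: "card (h ` T) = card T" if "T \<subseteq> S" for T
    using card_image[OF inj_on_subset[OF assms(1) that]] .
  have "{T. T \<subseteq> h ` S \<and> card T = k \<and> F T} = image h ` {T. T \<subseteq> S \<and> card T = k \<and> E T}"
    using assms(2) card by (fastforce simp: subset_image_iff)
  moreover have "inj_on (image h) {T. T \<subseteq> S \<and> card T = k \<and> E T}"
    by (rule inj_on_subset[OF inj_on_image_Pow[OF assms(1)]]) auto
  ultimately show ?thesis by (simp add: card_image)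
qed

text \<open>Edges off \<open>v\<close> are recovered by parity from those through \<open>v\<close>,
  on both sides, so only the link at \<open>v\<close> has to be compared. This rigidity drives
  uniqueness, embeddings, prolongation and the comparison of automorphism groups.\<close>

lemma even_edge_iso:
  assumes M: "even_hypergraph (k + 1) M" and N: "even_hypergraph (k + 1) N"
    and X: "X \<subseteq> univ M" "h ` X \<subseteq> univ N" "inj_on h X" "v \<in> X"
    and link: "\<And>P. P \<subseteq> X - {v} \<Longrightarrow> card P = k \<Longrightarrow>
      hyperedge M (insert v P) = hyperedge N (insert (h v) (h ` P))"
  shows "edge_iso (k + 1) (hyperedge M) (hyperedge N) X h"
  unfolding edge_iso_def
proof (intro conjI allI impI)
  fix T assume T: "T \<subseteq> X" "card T = k + 1"
  then have fT: "finite T" by (simp add: card_ge_0_finite)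
  show "hyperedge M T = hyperedge N (h ` T)"
  proof (cases "v \<in> T")
    case True
    have "hyperedge M (insert v (T - {v})) = hyperedge N (insert (h v) (h ` (T - {v})))"
      using T fT True by (intro link) auto
    moreover have "insert (h v) (h ` (T - {v})) = h ` T" using True by auto
    ultimately show ?thesis using True by (simp add: insert_absorb)
  next
    case False
    have inj: "inj_on h T" using X(3) T(1) by (rule inj_on_subset)
    have "hyperedge N (h ` T) \<longleftrightarrow>
        odd (card {P. P \<subseteq> h ` T \<and> card P = k \<and> hyperedge N (insert (h v) P)})"
    proof (rule even_hyperedge_iff[OF N])
      show "insert (h v) (h ` T) \<subseteq> univ N" using X T by auto
      show "h v \<notin> h ` T" using X T False by (auto dest: inj_onD)
      show "card (h ` T) = k + 1" using T inj by (simp add: card_image)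
    qed
    also have "card {P. P \<subseteq> h ` T \<and> card P = k \<and> hyperedge N (insert (h v) P)} =
        card {P. P \<subseteq> T \<and> card P = k \<and> hyperedge M (insert v P)}"
      using T False by (intro card_subsets_image[OF inj] link) auto
    also have "odd \<dots> \<longleftrightarrow> hyperedge M T"
      using X T False by (intro even_hyperedge_iff[OF M, symmetric]) auto
    finally show ?thesis by simp
  qed
qed (fact X)

text \<open>Double counting: each \<open>k\<close>-subset \<open>P\<close> of \<open>S\<close> lies
  in exactly two \<open>(k + 1)\<close>-subsets, one for each point of \<open>S - P\<close>. Hence
  the inner counts have even sum, and so an even number of them are odd.\<close>

lemma even_card_odd_subsets:
  assumes "card S = k + 2"
  shows "even (card {T. T \<subseteq> S \<and> card T = k + 1 \<and> odd (card {P. P \<subseteq> T \<and> card P = k \<and> E P})})"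
proof -
  have S: "finite S" using assms by (simp add: card_ge_0_finite)
  define A where "A = {T. T \<subseteq> S \<and> card T = k + 1}"
  define B where "B = {P. P \<subseteq> S \<and> card P = k \<and> E P}"
  have fin: "finite A" "finite B" using S by (auto simp: A_def B_def)
  have "card {T \<in> A. P \<subseteq> T} = 2" if "P \<in> B" for P
  proof -
    have P: "P \<subseteq> S" "card P = k" "finite P" using that S finite_subset by (auto simp: B_def)
    have "{T \<in> A. P \<subseteq> T} = (\<lambda>x. insert x P) ` (S - P)"
    proof
      show "{T \<in> A. P \<subseteq> T} \<subseteq> (\<lambda>x. insert x P) ` (S - P)"
      proof
        fix T assume T: "T \<in> {T \<in> A. P \<subseteq> T}"
        then have "card (T - P) = 1" using P by (simp add: A_def card_Diff_subset)
        then obtain x where "T - P = {x}" by (auto simp: card_1_singleton_iff)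
        then have "T = insert x P" "x \<in> S - P" using T by (auto simp: A_def)
        then show "T \<in> (\<lambda>x. insert x P) ` (S - P)" by blast
      qed
    qed (use P in \<open>auto simp: A_def\<close>)
    moreover have "inj_on (\<lambda>x. insert x P) (S - P)" by (rule inj_onI) blast
    ultimately show ?thesis using P assms by (simp add: card_image card_Diff_subset)
  qed
  then have "(\<Sum>T\<in>A. card {P \<in> B. P \<subseteq> T}) = 2 * card B"
    using fin by (intro sum_multicount) auto
  moreover have "{P \<in> B. P \<subseteq> T} = {P. P \<subseteq> T \<and> card P = k \<and> E P}" if "T \<in> A" for T
    using that by (auto simp: A_def B_def)
  ultimately have "even (\<Sum>T\<in>A. card {P. P \<subseteq> T \<and> card P = k \<and> E P})" by simp
  then have "even (card {T \<in> A. odd (card {P. P \<subseteq> T \<and> card P = k \<and> E P})})"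
    using fin by (simp add: even_sum_iff)
  then show ?thesis by (simp add: A_def conj_assoc)
qed

text \<open>For \<open>z\<close> outside \<open>univ M\<close> and \<open>M\<close> a
  \<open>k\<close>-hypergraph this is the mod 2 coboundary of the edge set of \<open>M\<close> with
  \<open>z\<close> added as an isolated point: if \<open>z \<in> T\<close>, the only
  \<open>k\<close>-subset of \<open>T\<close> that can be an edge is \<open>T - {z}\<close>. For
  \<open>k = 2\<close> it is the two-graph of that graph.\<close>

definition cone_edge :: "nat \<Rightarrow> 'a hyp \<Rightarrow> 'a \<Rightarrow> 'a set \<Rightarrow> bool" where
  "cone_edge k M z T \<longleftrightarrow> T \<subseteq> insert z (univ M) \<and> card T = k + 1 \<and>
    (if z \<in> T then hyperedge M (T - {z})
     else odd (card {P. P \<subseteq> T \<and> card P = k \<and> hyperedge M P}))"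

lemma even_hypergraph_cone:
  fixes k :: nat and M :: "'a hyp"
  assumes "z \<notin> univ M"
  defines "N \<equiv> hyp (insert z (univ M)) (\<lambda>xs. distinct xs \<and> cone_edge k M z (set xs))"
  shows "even_hypergraph (k + 1) N" "hyperedge N = cone_edge k M z"
proof -
  have "T \<subseteq> insert z (univ M) \<and> finite T \<and> card T = k + 1" if "cone_edge k M z T" for T
    using that by (simp add: cone_edge_def card_ge_0_finite)
  then have N: "hypergraph (k + 1) N" "hyperedge N = cone_edge k M z"
    unfolding N_def using hypergraph_of_edges[of "cone_edge k M z"] by auto
  show "hyperedge N = cone_edge k M z" by (fact N)
  have "even (card {T. T \<subseteq> S \<and> card T = k + 1 \<and> cone_edge k M z T})"
    if S: "S \<subseteq> insert z (univ M)" "card S = k + 2" for S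
  proof (cases "z \<in> S")
    case True
    define T where "T = S - {z}"
    have fS: "finite S" using S(2) by (simp add: card_ge_0_finite)
    have T: "finite T" "card T = k + 1" "z \<notin> T" "S = insert z T" "T \<subseteq> univ M"
      using S True fS by (auto simp: T_def)
    have "cone_edge k M z (insert z P) \<longleftrightarrow> hyperedge M P" if "P \<subseteq> T" "card P = k" for P
      using that T finite_subset[OF that(1)] by (auto simp: cone_edge_def card_insert_if)
    then have "{P. P \<subseteq> T \<and> card P = k \<and> cone_edge k M z (insert z P)} =
        {P. P \<subseteq> T \<and> card P = k \<and> hyperedge M P}" by auto
    moreover have "cone_edge k M z T \<longleftrightarrow> odd (card {P. P \<subseteq> T \<and> card P = k \<and> hyperedge M P})"
      using T by (auto simp: cone_edge_def)
    \<comment> \<open>The number of edges of \<open>M\<close> inside \<open>T\<close> is counted by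
      the sets through \<open>z\<close>; \<open>T\<close> itself adds one exactly when that number
      is odd, so the total is even.\<close>
    ultimately show ?thesis
      using card_subsets_insert[OF T(1-3), of "cone_edge k M z"] T(4) by simp
  next
    case False
    then have "{T. T \<subseteq> S \<and> card T = k + 1 \<and> cone_edge k M z T} =
        {T. T \<subseteq> S \<and> card T = k + 1 \<and> odd (card {P. P \<subseteq> T \<and> card P = k \<and> hyperedge M P})}"
      using S by (auto simp: cone_edge_def)
    then show ?thesis using even_card_odd_subsets[OF S(2)] by simp
  qed
  then show "even_hypergraph (k + 1) N"
    using N by (simp add: even_hypergraph_def) (simp add: N_def)
qed

section \<open>Heredity of the axioms under embeddings\<close>

lemma hypergraph_of_embedding:
  assumes A: "is_structure (hyp_lang k) A" and h: "embedding (hyp_lang k) A N h"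
    and N: "hypergraph k N"
  shows "hypergraph k A"
  unfolding hypergraph_def
proof (intro conjI ballI allI impI)
  have inj: "inj_on h (univ A)" and sub: "h ` univ A \<subseteq> univ N"
    and rel: "\<And>xs. xs \<in> tuples k (univ A) \<Longrightarrow> rels A () xs = rels N () (map h xs)"
    using h by (auto simp: embedding_def)
  show "is_structure (hyp_lang k) A" by (fact A)
  fix xs
  show "rels A () (permute_list p xs) = rels A () xs"
    if xs: "xs \<in> tuples k (univ A)" and p: "p permutes {..<k}" for p
  proof -
    have "map h xs \<in> tuples k (univ N)" using xs sub by (auto simp: tuples_def)
    then have "rels N () (permute_list p (map h xs)) = rels N () (map h xs)"
      using N p by (simp add: hypergraph_def)
    moreover have "permute_list p xs \<in> tuples k (univ A)" using xs p by (simp add: tuples_def)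
    moreover have "permute_list p (map h xs) = map h (permute_list p xs)"
      using xs p by (simp add: tuples_def permute_list_map)
    ultimately show ?thesis using rel xs by simp
  qed
  assume r: "rels A () xs"
  then have "xs \<in> tuples k (univ A)" using A by (simp add: is_structure_hyp_lang)
  with r rel N have "distinct (map h xs)" by (simp add: hypergraph_def)
  then show "distinct xs" by (simp add: distinct_map)
qed

text \<open>The parity axiom only speaks of finite subsets, so it pulls back along \<open>h\<close>.
  This gives one inclusion in the computation of the age.\<close>

lemma even_hypergraph_of_embedding:
  assumes A: "is_structure (hyp_lang k) A" and h: "embedding (hyp_lang k) A N h"
    and N: "even_hypergraph k N"
  shows "even_hypergraph k A"
proof -
  have hN: "hypergraph k N" using N by (simp add: even_hypergraph_def)
  have hA: "hypergraph k A" using hypergraph_of_embedding[OF A h hN] .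
  have *: "h ` univ A \<subseteq> univ N" "inj_on h (univ A)"
    "\<And>T. T \<subseteq> univ A \<Longrightarrow> card T = k \<Longrightarrow> hyperedge A T = hyperedge N (h ` T)"
    using h by (auto simp: embedding_hypergraph_iff[OF hA hN] edge_iso_def)
  have "even (card {T. T \<subseteq> S \<and> card T = k \<and> hyperedge A T})"
    if S: "S \<subseteq> univ A" "card S = k + 1" for S
  proof -
    have inj: "inj_on h S" using *(2) S(1) by (rule inj_on_subset)
    have "card {T. T \<subseteq> h ` S \<and> card T = k \<and> hyperedge N T} =
        card {T. T \<subseteq> S \<and> card T = k \<and> hyperedge A T}"
      using S by (intro card_subsets_image[OF inj] *(3)) auto
    moreover have "card (h ` S) = k + 1" "h ` S \<subseteq> univ N" using S * inj by (auto simp: card_image)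
    ultimately show ?thesis using N by (auto simp: even_hypergraph_def)
  qed
  with hA show ?thesis by (simp add: even_hypergraph_def)
qed

section \<open>The even hypergraph whose link at \<open>z\<close> is generic\<close>

text \<open>Only the link of \<open>N\<close> at \<open>z\<close> is fixed, not a formula for its
  edges, so the results apply to every extension satisfying the conditions of the theorem.\<close>

locale generic_link =
  fixes k :: nat and M N :: "'a hyp" and z :: 'a
  assumes k: "k \<ge> 1" and gen: "generic_hypergraph k M" and even_N: "even_hypergraph (k + 1) N"
    and univ_N: "univ N = insert z (univ M)" and z: "z \<notin> univ M"
    and link: "\<And>P. P \<subseteq> univ M \<Longrightarrow> card P = k \<Longrightarrow> hyperedge N (insert z P) \<longleftrightarrow> hyperedge M P"
begin

lemma M: "hypergraph k M" and count: "countable (univ M)"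
  using generic_hypergraphD[OF gen] by auto

lemma N: "hypergraph (k + 1) N"
  using even_N by (simp add: even_hypergraph_def)

text \<open>When \<open>z \<notin> Y\<close>, the edges of \<open>N\<close> through \<open>y\<close> and \<open>w\<close> are steered by the edges of \<open>M\<close>
  through \<open>y\<close> that avoid \<open>w\<close>: requiring that no edge of \<open>M\<close> contains both \<open>y\<close> and \<open>w\<close>,
  only two of the \<open>k\<close>-subsets of \<open>insert y (insert w P)\<close> contribute to the parity.\<close>

lemma realize_link:
  assumes Y: "finite Y" "Y \<subseteq> univ N" "Y \<noteq> {}"
  shows "\<exists>y\<in>univ N - Y. \<exists>w\<in>Y. \<forall>P\<subseteq>Y - {w}. card P + 1 = k \<longrightarrow>
    (hyperedge N (insert y (insert w P)) \<longleftrightarrow> D (insert w P))"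
proof (cases "z \<in> Y")
  \<comment> \<open>Take \<open>w = z\<close>: edges of \<open>N\<close> through \<open>z\<close>
    are edges of \<open>M\<close>, so the extension property applies directly.\<close>
  case True
  have "finite (Y - {z})" "Y - {z} \<subseteq> univ M" using Y univ_N by auto
  then obtain y where y: "y \<in> univ M - (Y - {z})"
    "\<And>P. P \<subseteq> Y - {z} \<Longrightarrow> card P + 1 = k \<Longrightarrow> hyperedge M (insert y P) \<longleftrightarrow> D (insert z P)"
    using generic_hypergraph_extension[OF gen, of "Y - {z}" "\<lambda>P. D (insert z P)"] by blast
  have "hyperedge N (insert y (insert z P)) \<longleftrightarrow> D (insert z P)"
    if P: "P \<subseteq> Y - {z}" "card P + 1 = k" for P
  proof -
    have "finite P" using P Y finite_subset by blast
    then have "hyperedge N (insert z (insert y P)) \<longleftrightarrow> hyperedge M (insert y P)"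
      using y P Y univ_N by (intro link) (auto simp: card_insert_if)
    then show ?thesis using y P by (simp add: insert_commute)
  qed
  moreover have "y \<in> univ N - Y" using y(1) z True univ_N by auto
  ultimately show ?thesis using True by blast
next
  case False
  then have YM: "Y \<subseteq> univ M" using Y univ_N by auto
  from Y obtain w where w: "w \<in> Y" by auto
  \<comment> \<open>The inequality is an exclusive or: \<open>insert y P\<close> is made an edge of
    \<open>M\<close> exactly when \<open>insert w P\<close> alone gives the wrong parity for
    \<open>D\<close>.\<close>
  obtain y where y: "y \<in> univ M - Y"
    and yE: "\<And>P. P \<subseteq> Y \<Longrightarrow> card P + 1 = k \<Longrightarrow> hyperedge M (insert y P) \<longleftrightarrow>
      w \<notin> P \<and> hyperedge M (insert w P) \<noteq> D (insert w P)"
    using generic_hypergraph_extension[OF gen Y(1) YM,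
        of "\<lambda>P. w \<notin> P \<and> hyperedge M (insert w P) \<noteq> D (insert w P)"] by blast
  have "hyperedge N (insert y (insert w P)) \<longleftrightarrow> D (insert w P)"
    if P: "P \<subseteq> Y - {w}" "card P + 1 = k" for P
  proof -
    have fP: "finite P" using P Y finite_subset by blast
    let ?T = "insert y (insert w P)"
    have T: "?T \<subseteq> univ M" "card ?T = k + 1" "y \<notin> insert w P"
      using y w P YM fP by (auto simp: card_insert_if)
    have "hyperedge N ?T \<longleftrightarrow> odd (card {Q. Q \<subseteq> ?T \<and> card Q = k \<and> hyperedge N (insert z Q)})"
      using T z univ_N by (intro even_hyperedge_iff[OF even_N]) auto
    \<comment> \<open>Writing \<open>k\<close> as \<open>(k - 1) + 1\<close>, valid as
      \<open>k \<ge> 1\<close>, prepares the split of the \<open>k\<close>-subsets by whether they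
      contain \<open>y\<close>.\<close>
    also have "{Q. Q \<subseteq> ?T \<and> card Q = k \<and> hyperedge N (insert z Q)} =
        {Q. Q \<subseteq> ?T \<and> card Q = (k - 1) + 1 \<and> hyperedge M Q}"
      using T link k by auto
    also have "card \<dots> = (if hyperedge M (insert w P) then 1 else 0) +
        card {Q. Q \<subseteq> insert w P \<and> card Q = k - 1 \<and> hyperedge M (insert y Q)}"
      using P T fP by (intro card_subsets_insert) (auto simp: card_insert_if)
    also have "{Q. Q \<subseteq> insert w P \<and> card Q = k - 1 \<and> hyperedge M (insert y Q)} =
        (if hyperedge M (insert w P) \<noteq> D (insert w P) then {P} else {})" (is "?L = ?R")
    proof -
      \<comment> \<open>Sets \<open>Q\<close> containing \<open>w\<close> contribute nothing by the
        choice of \<open>y\<close>, and \<open>P\<close> is the only \<open>(k - 1)\<close>-subset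
        that avoids \<open>w\<close>.\<close>
      have "Q = P" if "Q \<subseteq> insert w P" "card Q = k - 1" "w \<notin> Q" for Q
        using that P fP by (intro card_subset_eq) auto
      moreover have "hyperedge M (insert y Q) \<longleftrightarrow>
          w \<notin> Q \<and> hyperedge M (insert w Q) \<noteq> D (insert w Q)"
        if "Q \<subseteq> insert w P" "card Q = k - 1" for Q
        using that P w k by (intro yE) auto
      moreover have "w \<notin> P" "card P = k - 1" using P by auto
      ultimately show ?thesis by (auto split: if_splits)
    qed
    finally show ?thesis by (auto split: if_splits)
  qed
  moreover have "y \<in> univ N - Y" using y univ_N by auto
  ultimately show ?thesis using w by blast
qed

text \<open>By \<open>even_edge_iso\<close> it is enough to match the edges through one point
  \<open>v\<close> of \<open>X\<close>. Those without \<open>x\<close> are preserved by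
  \<open>h\<close>; those with \<open>x\<close> are arranged by \<open>realize_link\<close>.\<close>

lemma edge_iso_forth:
  assumes X: "finite X" "X \<subseteq> univ N" "h ` X \<subseteq> univ N"
    and h: "edge_iso (k + 1) (hyperedge N) (hyperedge N) X h" and x: "x \<in> univ N - X"
  shows "\<exists>y\<in>univ N. edge_iso (k + 1) (hyperedge N) (hyperedge N) (insert x X) (h(x := y))"
proof (cases "X = {}")
  case True
  \<comment> \<open>A single point carries no \<open>(k + 1)\<close>-set, because
    \<open>k \<ge> 1\<close>; any image of \<open>x\<close> works.\<close>
  have "card T \<noteq> k + 1" if "T \<subseteq> {x}" for T
    using card_mono[OF _ that] k by auto
  then show ?thesis using x True by (auto simp: edge_iso_def)
next
  case False
  from h have inj: "inj_on h X"
    and hE: "\<And>T. T \<subseteq> X \<Longrightarrow> card T = k + 1 \<Longrightarrow> hyperedge N T = hyperedge N (h ` T)"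
    by (auto simp: edge_iso_def)
  \<comment> \<open>The prescribed link is that of \<open>x\<close>, carried to the image of
    \<open>X\<close> by means of \<open>inv_into X h\<close>. The point \<open>v\<close> is then the
    preimage of the supplied \<open>w\<close>.\<close>
  obtain y w where y: "y \<in> univ N - h ` X" and "w \<in> h ` X"
    and yw: "\<And>P. P \<subseteq> h ` X - {w} \<Longrightarrow> card P + 1 = k \<Longrightarrow> hyperedge N (insert y (insert w P)) \<longleftrightarrow>
      hyperedge N (insert x (inv_into X h ` insert w P))"
    using realize_link[of "h ` X" "\<lambda>Q. hyperedge N (insert x (inv_into X h ` Q))"] X False
    by blast
  then obtain v where v: "v \<in> X" "w = h v" by auto
  have "edge_iso (k + 1) (hyperedge N) (hyperedge N) (insert x X) (h(x := y))"
  proof (rule even_edge_iso[OF even_N even_N])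
    show "insert x X \<subseteq> univ N" "v \<in> insert x X" using X x v by auto
    show "(h(x := y)) ` insert x X \<subseteq> univ N" using X x y by auto
    show "inj_on (h(x := y)) (insert x X)"
      using inj x y by (auto simp: inj_on_def)
    fix P assume P: "P \<subseteq> insert x X - {v}" "card P = k"
    have fP: "finite P" using P X finite_subset by blast
    have vx: "v \<noteq> x" using v x by auto
    show "hyperedge N (insert v P) =
      hyperedge N (insert ((h(x := y)) v) ((h(x := y)) ` P))"
    proof (cases "x \<in> P")
      case True
      define Q where "Q = P - {x}"
      have Q: "P = insert x Q" "Q \<subseteq> X - {v}" "card Q + 1 = k" "x \<notin> Q"
        using True P fP k by (auto simp: Q_def)
      have "card (h ` Q) = card Q" using inj Q by (intro card_image) (auto intro: inj_on_subset)
      moreover have "h ` Q \<subseteq> h ` X - {w}" using Q v inj by (auto dest: inj_onD)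
      moreover have "inv_into X h ` insert w (h ` Q) = insert v Q"
        using inv_into_image_cancel[OF inj, of "insert v Q"] v Q by auto
      ultimately have "hyperedge N (insert y (insert w (h ` Q))) \<longleftrightarrow> hyperedge N (insert x (insert v Q))"
        using yw[of "h ` Q"] Q by simp
      moreover have "(h(x := y)) ` P = insert y (h ` Q)" using Q by auto
      ultimately show ?thesis using vx v Q by (simp add: insert_commute)
    next
      case False
      have "hyperedge N (insert v P) = hyperedge N (h ` insert v P)"
        using P False v fP by (intro hE) (auto simp: card_insert_if)
      moreover have "(h(x := y)) ` P = h ` P" using False by auto
      ultimately show ?thesis using vx by simp
    qed
  qed
  then show ?thesis using y by auto
qed

lemma ultrahomogeneous_N: "ultrahomogeneous (hyp_lang (k + 1)) N"
  using count univ_N edge_iso_forth by (intro ultrahomogeneous_of_forth[OF N]) auto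

lemma finite_even_hypergraph_embeds:
  fixes A :: "nat hyp"
  assumes A: "even_hypergraph (k + 1) A" "finite (univ A)"
  shows "\<exists>h. embedding (hyp_lang (k + 1)) A N h"
proof (cases "univ A = {}")
  case True
  have hA: "hypergraph (k + 1) A" using A by (simp add: even_hypergraph_def)
  show ?thesis
    unfolding embedding_hypergraph_iff[OF hA N] using True by (simp add: edge_iso_def)
next
  case False
  then obtain v where v: "v \<in> univ A" by auto
  have hA: "hypergraph (k + 1) A" using A by (simp add: even_hypergraph_def)
  \<comment> \<open>The edges of the link of \<open>A\<close> at \<open>v\<close>. The resulting
    hypergraph \<open>L\<close> is finite and lives on natural numbers, so it belongs to the age of
    \<open>M\<close>.\<close>
  define E where "E P \<longleftrightarrow> P \<subseteq> univ A - {v} \<and> card P = k \<and> hyperedge A (insert v P)" for P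
  define L where "L = hyp (univ A - {v}) (\<lambda>xs. distinct xs \<and> E (set xs))"
  have "P \<subseteq> univ A - {v} \<and> finite P \<and> card P = k" if "E P" for P
    using that A(2) finite_subset[of P "univ A"] by (auto simp: E_def)
  then have L: "hypergraph k L" "hyperedge L = E"
    unfolding L_def using hypergraph_of_edges[of E] by auto
  have uL: "univ L = univ A - {v}" by (simp add: L_def)
  have "L \<in> age (hyp_lang k) M"
    using gen L uL A(2) by (simp add: generic_hypergraph_def generic_def)
  then obtain f where f: "embedding (hyp_lang k) L M f" by (auto simp: age_def)
  then have fM: "f ` (univ A - {v}) \<subseteq> univ M" "inj_on f (univ A - {v})"
    and fE: "\<And>P. P \<subseteq> univ A - {v} \<Longrightarrow> card P = k \<Longrightarrow> E P = hyperedge M (f ` P)"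
    by (auto simp: embedding_hypergraph_iff[OF L(1) M] edge_iso_def L(2) uL)
  have img: "(f(v := z)) ` univ A \<subseteq> univ N" using fM univ_N by auto
  have "edge_iso (k + 1) (hyperedge A) (hyperedge N) (univ A) (f(v := z))"
  proof (rule even_edge_iso[OF A(1) even_N _ img _ v])
    show "inj_on (f(v := z)) (univ A)"
    proof (rule inj_onI)
      fix a b assume "a \<in> univ A" "b \<in> univ A" "(f(v := z)) a = (f(v := z)) b"
      then show "a = b" using fM z inj_onD[OF fM(2), of a b]
        by (cases "a = v"; cases "b = v") auto
    qed
    fix P assume P: "P \<subseteq> univ A - {v}" "card P = k"
    have "f ` P \<subseteq> univ M" "card (f ` P) = k"
      using P fM card_image[OF inj_on_subset[OF fM(2) P(1)]] by auto
    moreover have "(f(v := z)) ` P = f ` P" using P by (intro image_cong) auto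
    ultimately show "hyperedge A (insert v P) =
        hyperedge N (insert ((f(v := z)) v) ((f(v := z)) ` P))"
      using P fE[OF P] link by (simp add: E_def)
  qed simp
  then show ?thesis using img embedding_hypergraph_iff[OF hA N] by blast
qed

lemma generic_even_N: "generic_even_hypergraph (k + 1) N"
proof -
  have "is_structure (hyp_lang (k + 1)) A" if "even_hypergraph (k + 1) A" for A :: "nat hyp"
    using that by (simp add: even_hypergraph_def hypergraph_def)
  then have "age (hyp_lang (k + 1)) N = {A. even_hypergraph (k + 1) A \<and> finite (univ A)}"
    unfolding age_def finitely_generated_hyp_lang
    using finite_even_hypergraph_embeds even_hypergraph_of_embedding[OF _ _ even_N] by blast
  then show ?thesis
    using N count univ_N ultrahomogeneous_N
    by (simp add: generic_even_hypergraph_def generic_def hypergraph_def)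
qed

section \<open>Automorphism groups and transitivity\<close>

lemma Aut_stabilizer: "{g \<in> Aut (hyp_lang (k + 1)) N. g z = z} = Aut (hyp_lang k) M"
proof (intro set_eqI iffI)
  fix g assume "g \<in> {g \<in> Aut (hyp_lang (k + 1)) N. g z = z}"
  then have g: "g permutes univ N" "g z = z"
    and gE: "\<And>T. T \<subseteq> univ N \<Longrightarrow> card T = k + 1 \<Longrightarrow> hyperedge N T = hyperedge N (g ` T)"
    unfolding Aut_hypergraph_iff[OF N] edge_iso_def by auto
  have gM: "g permutes univ M" using g(1) by (rule permutes_superset) (use g univ_N in auto)
  have "hyperedge M P = hyperedge M (g ` P)" if P: "P \<subseteq> univ M" "card P = k" for P
  proof -
    have "finite P" using P k by (simp add: card_ge_0_finite)
    then have "hyperedge N (insert z P) = hyperedge N (g ` insert z P)"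
      using P z univ_N by (intro gE) (auto simp: card_insert_if)
    moreover have "g ` P \<subseteq> univ M" "card (g ` P) = k"
      using P permutes_image[OF gM] card_image[OF permutes_inj_on[OF gM]] by auto
    ultimately show ?thesis using P link g(2) by simp
  qed
  then show "g \<in> Aut (hyp_lang k) M"
    using gM by (auto simp: Aut_hypergraph_iff[OF M] edge_iso_def permutes_inj_on)
next
  fix g assume "g \<in> Aut (hyp_lang k) M"
  then have g: "g permutes univ M"
    and gE: "\<And>T. T \<subseteq> univ M \<Longrightarrow> card T = k \<Longrightarrow> hyperedge M T = hyperedge M (g ` T)"
    by (auto simp: Aut_hypergraph_iff[OF M] edge_iso_def)
  have gz: "g z = z" using g z by (rule permutes_not_in)
  have gN: "g permutes univ N" using g univ_N by (auto intro: permutes_subset)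
  \<comment> \<open>An automorphism of \<open>M\<close> preserves the link at the fixed point
    \<open>z\<close>, and the link determines \<open>N\<close>.\<close>
  have "edge_iso (k + 1) (hyperedge N) (hyperedge N) (univ N) g"
  proof (rule even_edge_iso[OF even_N even_N])
    show "g ` univ N \<subseteq> univ N" "inj_on g (univ N)" "z \<in> univ N"
      using permutes_image[OF gN] permutes_inj_on[OF gN] univ_N by auto
    fix P assume "P \<subseteq> univ N - {z}" "card P = k"
    then have P: "P \<subseteq> univ M" "card P = k" using univ_N by auto
    moreover have "g ` P \<subseteq> univ M" "card (g ` P) = k"
      using P permutes_image[OF g] card_image[OF permutes_inj_on[OF g]] by auto
    ultimately show "hyperedge N (insert z P) = hyperedge N (insert (g z) (g ` P))"
      using gE link gz by simp
  qed simp
  then show "g \<in> {g \<in> Aut (hyp_lang (k + 1)) N. g z = z}"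
    unfolding Aut_hypergraph_iff[OF N] using gN gz by simp
qed

lemma transitive_extension:
  "transitive_one_point_extension (hyp_lang k) M z (hyp_lang (k + 1)) N"
proof -
  have "one_point_extension (hyp_lang k) M z (hyp_lang (k + 1)) N"
    using M N univ_N z Aut_stabilizer
    by (simp add: one_point_extension_def hypergraph_def)
  moreover have "\<exists>g\<in>Aut (hyp_lang (k + 1)) N. g x = y" if "x \<in> univ N" "y \<in> univ N" for x y
  proof -
    \<comment> \<open>Any map between single points is a partial isomorphism, since no
      \<open>(k + 1)\<close>-set fits inside; ultrahomogeneity then extends it.\<close>
    have "card T \<noteq> k + 1" if "T \<subseteq> {x}" for T
      using card_mono[OF _ that] k by auto
    then have "edge_iso (k + 1) (hyperedge N) (hyperedge N) {x} (\<lambda>_. y)"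
      by (auto simp: edge_iso_def)
    moreover have "finite {x}" "{x} \<subseteq> univ N" "(\<lambda>_. y) ` {x} \<subseteq> univ N" using that by auto
    ultimately have "\<exists>g\<in>Aut (hyp_lang (k + 1)) N. \<forall>u\<in>{x}. g u = y"
      using ultrahomogeneous_N[unfolded ultrahomogeneous_hypergraph_iff[OF N]] by blast
    then show ?thesis by simp
  qed
  ultimately show ?thesis by (simp add: transitive_one_point_extension_def)
qed

end

section \<open>Existence, uniqueness and genericity of the extension\<close>

theorem proposition3p2:
  fixes k :: nat and G :: "'a set" and R :: "'a list \<Rightarrow> bool" and z :: 'a
  assumes "k \<ge> 2"
    and "generic_hypergraph k (hyp G R)"
    and "z \<notin> G"
  shows "(\<exists>!R'. even_hypergraph (k + 1) (hyp (insert z G) R') \<and>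
                (\<forall>xs\<in>tuples k G. R xs \<longleftrightarrow> R' (xs @ [z]))) \<and>
         (\<forall>R'. even_hypergraph (k + 1) (hyp (insert z G) R') \<and>
               (\<forall>xs\<in>tuples k G. R xs \<longleftrightarrow> R' (xs @ [z])) \<longrightarrow>
               generic_even_hypergraph (k + 1) (hyp (insert z G) R') \<and>
               transitive_one_point_extension (hyp_lang k) (hyp G R) z
                 (hyp_lang (k + 1)) (hyp (insert z G) R'))"
proof -
  let ?M = "hyp G R" and ?N = "hyp (insert z G)"
  let ?ext = "\<lambda>R'. even_hypergraph (k + 1) (?N R') \<and> (\<forall>xs\<in>tuples k G. R xs \<longleftrightarrow> R' (xs @ [z]))"
  have M: "hypergraph k ?M" using generic_hypergraphD[OF assms(2)] by simp
  note R = rels_iff_hyperedge[OF M, simplified]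
  have link: "generic_link k ?M (?N R') z" if R': "?ext R'" for R'
  proof
    show "hyperedge (?N R') (insert z P) \<longleftrightarrow> hyperedge ?M P"
      if P: "P \<subseteq> univ ?M" "card P = k" for P
    proof -
      have "finite P" using P assms(1) by (simp add: card_ge_0_finite)
      then obtain xs where xs: "set xs = P" "distinct xs" using finite_distinct_list by blast
      have hN: "hypergraph (k + 1) (?N R')" using R' by (simp add: even_hypergraph_def)
      have "xs \<in> tuples k G" using P xs by (auto simp: tuples_def distinct_card)
      then have "R xs \<longleftrightarrow> R' (xs @ [z])" using R' by blast
      \<comment> \<open>As \<open>z \<notin> G\<close>, appending \<open>z\<close> keeps the list
        repetition-free, so the tuple condition becomes the link condition on sets.\<close>
      moreover have "R' (xs @ [z]) \<longleftrightarrow> hyperedge (?N R') (insert z P)"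
        using rels_iff_hyperedge[OF hN, of "xs @ [z]"] xs P assms(3) by auto
      ultimately show ?thesis using R[of xs] xs by simp
    qed
  qed (use R' assms in auto)
  have ext: "?ext (\<lambda>xs. distinct xs \<and> cone_edge k ?M z (set xs))"
  proof (intro conjI ballI)
    show "even_hypergraph (k + 1) (?N (\<lambda>xs. distinct xs \<and> cone_edge k ?M z (set xs)))"
      using even_hypergraph_cone[of z ?M k] assms(3) by simp
    fix xs assume "xs \<in> tuples k G"
    then have xs: "length xs = k" "set xs \<subseteq> G" "z \<notin> set xs" using assms(3) by (auto simp: tuples_def)
    have "cone_edge k ?M z (insert z (set xs)) \<longleftrightarrow> hyperedge ?M (set xs)" if "distinct xs"
      using xs that by (auto simp: cone_edge_def distinct_card)
    then show "R xs \<longleftrightarrow> distinct (xs @ [z]) \<and> cone_edge k ?M z (set (xs @ [z]))"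
      using R[of xs] xs by auto
  qed
  have unique: "R1 = R2" if R1: "?ext R1" and R2: "?ext R2" for R1 R2
  proof
    fix xs
    interpret N1: generic_link k ?M "?N R1" z using link[OF R1] .
    interpret N2: generic_link k ?M "?N R2" z using link[OF R2] .
    \<comment> \<open>Both extensions have link \<open>?M\<close> at \<open>z\<close>, so rigidity
      applies to the identity map.\<close>
    have "edge_iso (k + 1) (hyperedge (?N R1)) (hyperedge (?N R2)) (insert z G) id"
      by (rule even_edge_iso[OF N1.even_N N2.even_N, where v = z])
        (use N1.link N2.link assms(3) in auto)
    then have "hyperedge (?N R1) T = hyperedge (?N R2) T"
      if "T \<subseteq> insert z G" "card T = k + 1" for T
      using that by (simp add: edge_iso_def)
    \<comment> \<open>Equality of \<open>R1\<close> and \<open>R2\<close> is required on all lists,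
      so edges are also compared on sets of other sizes or outside the universe, where neither
      hypergraph has any.\<close>
    moreover have "T \<subseteq> insert z G \<and> card T = k + 1"
      if "hyperedge (?N R1) T \<or> hyperedge (?N R2) T" for T
      using that hyperedgeD[OF N1.N, of T] hyperedgeD[OF N2.N, of T] by auto
    ultimately have "hyperedge (?N R1) T = hyperedge (?N R2) T" for T
      by blast
    then show "R1 xs = R2 xs"
      using rels_iff_hyperedge[OF N1.N, of xs] rels_iff_hyperedge[OF N2.N, of xs] by simp
  qed
  have "\<exists>!R'. ?ext R'" using ext unique[OF _ ext] by (rule ex1I)
  moreover have "generic_even_hypergraph (k + 1) (?N R') \<and>
      transitive_one_point_extension (hyp_lang k) ?M z (hyp_lang (k + 1)) (?N R')"
    if R': "?ext R'" for R'
  proof -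
    interpret generic_link k ?M "?N R'" z using link[OF R'] .
    show ?thesis using generic_even_N transitive_extension by simp
  qed
  ultimately show ?thesis by blast
qed

end
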